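(* Let $n\in\mathbb{N}$. Every construction $C_n\subseteq G_n$ that is peaceful for $\theta=135^\circ$ satisfies $|C_n|\le 3n-2$.
   Context: $G_n=\{(x,y): x,y\in\{1,\dots,n\}\}$; a construction is a subset of $G_n$. Three distinct points $A,B,C$ form an angle of $\theta$ if one of the interior angles of the triangle $ABC$ equals $\theta$; a construction is peaceful for $\theta$ if no three of its points form an angle of $\theta$. *)

theory Defs
  imports "HOL-Analysis.Analysis"
begin

definition grid :: "nat \<Rightarrow> (real \<times> real) set" where
  "grid n = {(real x, real y) | x y. x \<in> {1..n} \<and> y \<in> {1..n}}"

(* The angle at the vertex B between the rays BA and BC, in radians and in [0, pi];
   meaningful for A \<noteq> B and C \<noteq> B. *)
definition angle :: "'a::real_inner \<Rightarrow> 'a \<Rightarrow> 'a \<Rightarrow> real" where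
  "angle A B C = arccos (((A - B) \<bullet> (C - B)) / (norm (A - B) * norm (C - B)))"

(* Collinear triples count as degenerate triangles, with angles 0 and pi only. *)
definition form_angle :: "real \<Rightarrow> 'a::real_inner \<Rightarrow> 'a \<Rightarrow> 'a \<Rightarrow> bool" where
  "form_angle \<theta> A B C \<longleftrightarrow>
     A \<noteq> B \<and> B \<noteq> C \<and> A \<noteq> C \<and>
     (angle B A C = \<theta> \<or> angle A B C = \<theta> \<or> angle A C B = \<theta>)"

definition peaceful :: "real \<Rightarrow> 'a::real_inner set \<Rightarrow> bool" where
  "peaceful \<theta> S \<longleftrightarrow> \<not> (\<exists>A\<in>S. \<exists>B\<in>S. \<exists>C\<in>S. form_angle \<theta> A B C)"

end

theory Submission
  imports Defs
begin

text \<open>A point with another point of the construction due east and a third one due north-west is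
  the vertex of an angle of 135 degrees. Hence in a peaceful construction every point is the
  easternmost of its row or the north-western end of its antidiagonal. There are \<open>n\<close> rows and
  \<open>2 * n - 1\<close> antidiagonals, which gives \<open>3 * n - 1\<close>. One is saved at the corner \<open>(n, n)\<close>: if it is
  present it is an end of both kinds, and otherwise its antidiagonal is empty.\<close>

text \<open>Seen from \<open>p\<close>, the other two points lie at \<open>(a, 0)\<close> and
  \<open>(- b, b)\<close> with \<open>a, b > 0\<close>; the lengths cancel and the cosine is
  \<open>- 1 / sqrt 2\<close>.\<close>

lemma angle_east_northwest:
  fixes p q r :: "real \<times> real"
  assumes "snd q = snd p" "fst p < fst q"
    and "fst r + snd r = fst p + snd p" "fst r < fst p"
  shows "angle q p r = 3 * pi / 4"
proof -
  define a where "a = fst q - fst p"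
  define b where "b = fst p - fst r"
  have pos: "a > 0" "b > 0" using assms by (auto simp: a_def b_def)
  have q: "q - p = (a, 0)" using assms by (simp add: a_def prod_eq_iff)
  have r: "r - p = (- b, b)" using assms by (simp add: b_def prod_eq_iff)
  have "norm (- b, b) = sqrt 2 * b"
    using pos by (simp add: norm_Pair real_sqrt_mult flip: mult_2)
  then have "(q - p) \<bullet> (r - p) / (norm (q - p) * norm (r - p)) = - (1 / sqrt 2)"
    using pos unfolding q r by (simp add: norm_Pair)
  also have "\<dots> = - cos (pi / 4)" by (simp add: cos_45 real_div_sqrt field_simps)
  also have "\<dots> = cos (3 * pi / 4)" using cos_pi_minus[of "pi / 4"] by simp
  finally show ?thesis by (simp add: angle_def arccos_cos)
qed

theorem theorem3:
  fixes n :: nat and C :: "(real \<times> real) set"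
  assumes "n \<ge> 1"
    and "C \<subseteq> grid n"
    and "peaceful (3 * pi / 4) C"
  shows "int (card C) \<le> 3 * int n - 2"
proof -
  define R where "R = {p \<in> C. \<forall>q\<in>C. snd q = snd p \<longrightarrow> fst q \<le> fst p}"
  \<comment> \<open>The coordinate sum is constant along an antidiagonal, so the least first
    coordinate marks its north-western end.\<close>
  define D where "D = {p \<in> C. \<forall>q\<in>C. fst q + snd q = fst p + snd p \<longrightarrow> fst p \<le> fst q}"
  define c where "c = (real n, real n)"
  have grid: "\<exists>x y. p = (real x, real y) \<and> x \<in> {1..n} \<and> y \<in> {1..n}" if "p \<in> C" for p
    using that assms(2) by (auto simp: grid_def)
  have "C \<subseteq> R \<union> D"
  proof (rule subsetI, rule ccontr)
    fix p assume p: "p \<in> C" "p \<notin> R \<union> D"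
    \<comment> \<open>Failing to be in \<open>R\<close> yields a point \<open>q\<close> to the east,
      failing to be in \<open>D\<close> a point \<open>r\<close> to the north-west.\<close>
    then obtain q r where q: "q \<in> C" "snd q = snd p" "fst p < fst q"
      and r: "r \<in> C" "fst r + snd r = fst p + snd p" "fst r < fst p"
      by (auto simp: R_def D_def not_le)
    then have "form_angle (3 * pi / 4) q p r"
      by (auto simp: form_angle_def angle_east_northwest)
    with p q r assms(3) show False unfolding peaceful_def by blast
  qed
  moreover have "R \<union> D \<subseteq> C" by (auto simp: R_def D_def)
  ultimately have C: "C = R \<union> D" by blast
  have injR: "inj_on snd R"
  proof (rule inj_onI)
    fix p q assume "p \<in> R" "q \<in> R" and eq: "snd p = snd q"
    then have "fst p \<le> fst q" "fst q \<le> fst p" by (simp_all add: R_def)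
    with eq show "p = q" by (simp add: prod_eq_iff)
  qed
  have imR: "snd ` R \<subseteq> real ` {1..n}"
    unfolding R_def by (auto dest!: grid)
  have finR: "finite R" and cardR: "card R \<le> n"
    using inj_on_finite[OF injR imR] card_inj_on_le[OF injR imR] by (simp_all add: card_image)
  have injD: "inj_on (\<lambda>p. fst p + snd p) D"
  proof (rule inj_onI)
    fix p q assume "p \<in> D" "q \<in> D" and eq: "fst p + snd p = fst q + snd q"
    then have "fst p \<le> fst q" "fst q \<le> fst p" by (simp_all add: D_def)
    with eq show "p = q" by (simp add: prod_eq_iff)
  qed
  \<comment> \<open>The sum names the antidiagonal. Among grid points only the corner
    \<open>c\<close> has sum \<open>2 * n\<close>, so this value drops out when \<open>c\<close> is
    missing.\<close>
  have imD: "fst p + snd p \<in> real ` {2..2 * n - (if c \<in> C then 0 else 1)}" if "p \<in> D" for p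
  proof -
    have "p \<in> C" using that by (simp add: D_def)
    then obtain x y where xy: "p = (real x, real y)" "x \<in> {1..n}" "y \<in> {1..n}"
      using grid by blast
    have "x + y \<noteq> 2 * n" if "c \<notin> C"
    proof
      assume "x + y = 2 * n"
      then have "x = n" "y = n" using xy by auto
      with xy \<open>p \<in> C\<close> that show False by (simp add: c_def)
    qed
    then have "x + y \<in> {2..2 * n - (if c \<in> C then 0 else 1)}" using xy by auto
    then show ?thesis using xy by (metis fst_conv snd_conv of_nat_add imageI)
  qed
  then have imD': "(\<lambda>p. fst p + snd p) ` D \<subseteq> real ` {2..2 * n - (if c \<in> C then 0 else 1)}"
    by blast
  have finD: "finite D" and cardD: "card D \<le> 2 * n - 1 - (if c \<in> C then 0 else 1)"
    using inj_on_finite[OF injD imD'] card_inj_on_le[OF injD imD']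
    by (auto simp: card_image split: if_splits)
  have "c \<in> R \<inter> D" if "c \<in> C"
  proof -
    have "fst q \<le> real n" "snd q \<le> real n" if "q \<in> C" for q
      using grid[OF that] by auto
    \<comment> \<open>Membership in \<open>D\<close>: a point with sum \<open>2 * n\<close> and
      second coordinate at most \<open>n\<close> has first coordinate at least
      \<open>n\<close>.\<close>
    then show ?thesis using that by (fastforce simp: R_def D_def c_def)
  qed
  then have "card (R \<inter> D) \<ge> (if c \<in> C then 1 else 0)"
    using finR by (auto simp: Suc_le_eq card_gt_0_iff)
  moreover have "card C + card (R \<inter> D) = card R + card D"
    unfolding C using card_Un_Int[OF finR finD] by simp
  \<comment> \<open>With \<open>c\<close> the bound is \<open>n + (2 * n - 1) - 1\<close>, without
    it \<open>n + (2 * n - 2)\<close>; \<open>n \<ge> 1\<close> makes the truncated subtractions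
    exact.\<close>
  ultimately show ?thesis using cardR cardD assms(1) by (auto split: if_splits)
qed

end
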